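(* Let $S$ be a $*$-monoid, let $a,w\in S$ and let $n\geq 2$ be an integer. Then the following conditions are equivalent: (i) $a$ is $w$-core invertible. (ii) $a\in S[(aw)^*]^{n}a\cap S(aw)^{n-1}a$. (iii) $a\in awS$ and $aw$ is core invertible. In this case, writing $a_w^{\#}$ for the $w$-core inverse of $a$ and $(aw)^{c}$ for the core inverse of $aw$, one has $a_w^{\#}=(aw)^{c}=w^{\parallel a}w(aw)^{(1,3)}$.
   Context: A $*$-monoid is a semigroup $S$ with identity $1$ and a map $*$ satisfying $(x^* )^*=x$ and $(xy)^*=y^*x^*$ for all $x,y\in S$. For $a,w\in S$, $a$ is $w$-core invertible if there exists $x\in S$ with $awx^2=x$, $xawa=a$ and $(awx)^*=awx$. Such an $x$ is unique if it exists and is called the $w$-core inverse of $a$. The case $w=1$ is the core inverse: $b\in S$ is core invertible if there is $x\in S$ with $bx^2=x$, $xb^2=b$, $(bx)^*=bx$; this unique $x$ is the core inverse of $b$. For $c,d\in S$, $c$ is invertible along $d$ if there exists $b\in S$ with $bcd=d=dcb$ and $b\in dS\cap Sd$. Such a $b$ is unique if it exists and is denoted $c^{\parallel d}$. A $\{1,3\}$-inverse of $b$ is an $x\in S$ with $bxb=b$ and $(bx)^*=bx$; $b^{(1,3)}$ denotes an arbitrary $\{1,3\}$-inverse of $b$. *)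

theory Defs
  imports Main
begin

class star_monoid = monoid_mult +
  fixes star :: "'a \<Rightarrow> 'a"
  assumes star_star: "star (star x) = x"
    and star_mult: "star (x * y) = star y * star x"

context star_monoid
begin

definition is_w_core_inverse :: "'a \<Rightarrow> 'a \<Rightarrow> 'a \<Rightarrow> bool" where
  "is_w_core_inverse w a x \<longleftrightarrow>
     a * w * x ^ 2 = x \<and> x * a * w * a = a \<and> star (a * w * x) = a * w * x"

definition w_core_invertible :: "'a \<Rightarrow> 'a \<Rightarrow> bool" where
  "w_core_invertible w a \<longleftrightarrow> (\<exists>x. is_w_core_inverse w a x)"

definition w_core_inverse :: "'a \<Rightarrow> 'a \<Rightarrow> 'a" where
  "w_core_inverse w a = (THE x. is_w_core_inverse w a x)"

definition is_core_inverse :: "'a \<Rightarrow> 'a \<Rightarrow> bool" where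
  "is_core_inverse b x \<longleftrightarrow>
     b * x ^ 2 = x \<and> x * b ^ 2 = b \<and> star (b * x) = b * x"

definition core_invertible :: "'a \<Rightarrow> bool" where
  "core_invertible b \<longleftrightarrow> (\<exists>x. is_core_inverse b x)"

definition core_inverse :: "'a \<Rightarrow> 'a" where
  "core_inverse b = (THE x. is_core_inverse b x)"

text \<open>The principal one-sided ideals \<open>S x\<close> and \<open>x S\<close>.\<close>

definition left_ideal :: "'a \<Rightarrow> 'a set" where
  "left_ideal x = {s * x |s. True}"

definition right_ideal :: "'a \<Rightarrow> 'a set" where
  "right_ideal x = {x * s |s. True}"

definition is_inverse_along :: "'a \<Rightarrow> 'a \<Rightarrow> 'a \<Rightarrow> bool" where
  "is_inverse_along c d b \<longleftrightarrow>
     b * c * d = d \<and> d = d * c * b \<and> b \<in> right_ideal d \<inter> left_ideal d"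

definition invertible_along :: "'a \<Rightarrow> 'a \<Rightarrow> bool" where
  "invertible_along c d \<longleftrightarrow> (\<exists>b. is_inverse_along c d b)"

definition inverse_along :: "'a \<Rightarrow> 'a \<Rightarrow> 'a" where
  "inverse_along c d = (THE b. is_inverse_along c d b)"

definition is_13_inverse :: "'a \<Rightarrow> 'a \<Rightarrow> bool" where
  "is_13_inverse b x \<longleftrightarrow> b * x * b = b \<and> star (b * x) = b * x"

lemma is_core_inverse_iff: "is_core_inverse b x \<longleftrightarrow> is_w_core_inverse 1 b x"
  by (simp add: is_core_inverse_def is_w_core_inverse_def power2_eq_square mult.assoc)

text \<open>The inverses given above by definite descriptions are unique when they exist.\<close>

lemma is_core_inverse_unique:
  assumes "is_core_inverse b x" and "is_core_inverse b y"
  shows "x = y"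
proof -
  have x: "b * (x * x) = x" "x * (b * b) = b" "star (b * x) = b * x"
    and y: "b * (y * y) = y" "y * (b * b) = b" "star (b * y) = b * y"
    using assms by (auto simp: is_core_inverse_def power2_eq_square)
  have xby: "x * (b * y) = y" by (metis x(2) y(1) mult.assoc)
  have ybx: "y * (b * x) = x" by (metis x(1) y(2) mult.assoc)
  have yby: "y * (b * y) = y" by (metis y mult.assoc)
  have byb: "b * (y * b) = b" by (metis y(1,2) mult.assoc)
  have "b * y = star ((b * x) * (b * y))" using xby y(3) by (simp add: mult.assoc)
  also have "\<dots> = (b * y) * (b * x)" by (metis star_mult x(3) y(3))
  also have "\<dots> = b * x" by (metis byb mult.assoc)
  finally show ?thesis using ybx yby by simp
qed

lemma is_w_core_inverse_imp_core:
  assumes "is_w_core_inverse w a x"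
  shows "is_core_inverse (a * w) x"
  using assms unfolding is_w_core_inverse_def is_core_inverse_def power2_eq_square
  by (metis mult.assoc)

lemma is_w_core_inverse_unique:
  "is_w_core_inverse w a x \<Longrightarrow> is_w_core_inverse w a y \<Longrightarrow> x = y"
  using is_core_inverse_unique is_w_core_inverse_imp_core by blast

lemma is_inverse_along_unique:
  assumes "is_inverse_along c d b" and "is_inverse_along c d b'"
  shows "b = b'"
proof -
  obtain s t where s: "b = d * s" and t: "b' = t * d"
    using assms by (auto simp: is_inverse_along_def right_ideal_def left_ideal_def)
  have "b' * c * b = b"
    using assms(2) s by (metis is_inverse_along_def mult.assoc)
  moreover have "b' * c * b = b'"
    using assms(1) t by (metis is_inverse_along_def mult.assoc)
  ultimately show ?thesis by simp
qed

end

end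

theory Submission
  imports Defs
begin

text \<open>
  Write \<open>b = a w\<close>. A core inverse \<open>x\<close> of \<open>b\<close> satisfies \<open>b\<^sup>k x\<^sup>k = b x\<close> for \<open>k \<ge> 1\<close>, a projection
  fixing \<open>b S\<close>; taking adjoints of \<open>b\<^sup>n x\<^sup>n\<close> turns \<open>a = b\<^sup>n x\<^sup>n a\<close> into \<open>a \<in> S (b\<^sup>*)\<^sup>n a\<close>, and
  iterating \<open>a = x b a\<close> gives \<open>a \<in> S b\<^sup>k a\<close>. Conversely, \<open>a = s (b\<^sup>*)\<^sup>n a\<close> makes
  \<open>b\<^sup>n s\<^sup>*\<close> a projection fixing \<open>a\<close>, so \<open>y = b\<^sup>n\<^sup>-\<^sup>1 s\<^sup>*\<close> is a \<open>{1,3}\<close>-inverse of \<open>b\<close> and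
  \<open>b \<in> b\<^sup>n S\<close>; together with \<open>b \<in> S b\<^sup>n\<close> this yields a group inverse \<open>g\<close> of \<open>b\<close>, and
  \<open>g b y\<close> is the core inverse.
\<close>

context star_monoid
begin

lemma w_core_inverse_eqI: "is_w_core_inverse w a x \<Longrightarrow> w_core_inverse w a = x"
  unfolding w_core_inverse_def by (blast intro: the_equality is_w_core_inverse_unique)

lemma core_inverse_eqI: "is_core_inverse b x \<Longrightarrow> core_inverse b = x"
  unfolding core_inverse_def by (blast intro: the_equality is_core_inverse_unique)

lemma inverse_along_eqI: "is_inverse_along c d b \<Longrightarrow> inverse_along c d = b"
  unfolding inverse_along_def by (blast intro: the_equality is_inverse_along_unique)

lemma star_1: "star 1 = 1"
  by (metis mult_1_left mult_1_right star_mult star_star)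

lemma star_power: "star (x ^ k) = star x ^ k"
  by (induction k) (simp_all add: star_1 star_mult power_commutes)

lemma is_core_inverseD:
  assumes "is_core_inverse b x"
  shows "b * (x * x) = x" "x * (b * b) = b" "star (b * x) = b * x"
    "b * (x * b) = b" "x * (b * x) = x"
proof -
  show x: "b * (x * x) = x" "x * (b * b) = b" "star (b * x) = b * x"
    using assms by (auto simp: is_core_inverse_def power2_eq_square)
  show "b * (x * b) = b" "x * (b * x) = x"
    by (metis x(1,2) mult.assoc)+
qed

lemma core_inverse_is_13_inverse:
  assumes "is_core_inverse b x"
  shows "is_13_inverse b x"
  using is_core_inverseD[OF assms] by (simp add: is_13_inverse_def mult.assoc)

text \<open>The innermost block \<open>b * (x * x)\<close> collapses to \<open>x\<close>, so each
  extra pair of factors cancels down to \<open>b * x\<close>.\<close>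

lemma core_inverse_power_mult:
  assumes "is_core_inverse b x"
  shows "b ^ Suc k * x ^ Suc k = b * x"
proof (induction k)
  case (Suc k)
  have "b ^ Suc (Suc k) * x ^ Suc (Suc k) = b ^ Suc k * (b * (x * x)) * x ^ k"
    by (simp only: power_Suc2[of b "Suc k"] power_Suc[of x] mult.assoc)
  also have "\<dots> = b ^ Suc k * x ^ Suc k"
    by (simp add: is_core_inverseD(1)[OF assms] mult.assoc)
  finally show ?case using Suc.IH by simp
qed simp

lemma core_inverse_power_absorb:
  assumes "is_core_inverse b x"
  shows "x ^ k * b ^ Suc k = b"
proof (induction k)
  case (Suc k)
  have "x ^ Suc k * b ^ Suc (Suc k) = x ^ k * (x * (b * b)) * b ^ k"
    by (simp only: power_Suc2[of x] power_Suc[of b] mult.assoc)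
  also have "\<dots> = x ^ k * b ^ Suc k"
    by (simp add: is_core_inverseD(2)[OF assms] mult.assoc)
  finally show ?case using Suc.IH by simp
qed simp

text \<open>The group inverse of \<open>b\<close> is \<open>v b u\<close>.\<close>

lemma is_core_inverse_group_13:
  assumes u: "b = b * b * u" and v: "b = v * b * b" and y: "is_13_inverse b y"
  shows "is_core_inverse b (v * b * u * b * y)"
proof -
  have y1: "b * (y * b) = b" and y3: "star (b * y) = b * y"
    using y by (simp_all add: is_13_inverse_def mult.assoc)
  \<comment> \<open>Both sides equal \<open>v * b * b * u\<close>; this common idempotent fixes
    \<open>b\<close> from either side.\<close>
  have vu: "v * b = b * u" by (metis u v mult.assoc)
  have bx: "b * (v * b * u * b * y) = b * y" by (metis u v vu mult.assoc)
  have xbb: "v * b * u * b * y * (b * b) = b" by (metis u v vu y1 mult.assoc)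
  \<comment> \<open>By \<open>vu\<close> the candidate starts with \<open>b\<close>, and
    \<open>b * y\<close> fixes \<open>b S\<close> from the left.\<close>
  have "b * y * (v * b * u * b * y) = v * b * u * b * y" by (metis vu y1 mult.assoc)
  then show ?thesis
    unfolding is_core_inverse_def power2_eq_square
    using bx xbb y3 by (metis mult.assoc)
qed

lemma star_power_projection:
  assumes c: "c = s * (star b ^ Suc k * c)" and b: "b = s * (star b ^ Suc k * b)"
  shows "is_13_inverse b (b ^ k * star s)" "c = b * (b ^ k * star s) * c"
proof -
  define p where "p = b * (b ^ k * star s)"
  have sp: "star p = s * star b ^ Suc k"
    by (simp only: p_def mult.assoc[symmetric] power_Suc[symmetric] star_mult star_star star_power)
  \<comment> \<open>By \<open>b\<close>, \<open>star p\<close> fixes \<open>b\<close> from the left,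
    and \<open>p\<close> lies in \<open>b S\<close>. As \<open>star p * p\<close> is self-adjoint,
    so is \<open>p\<close>.\<close>
  have "star p * p = p" using b sp unfolding p_def by (metis mult.assoc)
  then have p: "star p = p" by (metis star_mult star_star)
  show "c = b * (b ^ k * star s) * c" using c sp p unfolding p_def by (metis mult.assoc)
  have "p * b = b" using b sp p by (metis mult.assoc)
  then show "is_13_inverse b (b ^ k * star s)"
    using p by (simp add: is_13_inverse_def p_def)
qed

text \<open>Reduces the weighted notion to the ordinary one: for \<open>a = a * w * r\<close>, the
  core law \<open>x * (a * w) * (a * w) = a * w\<close> multiplied by \<open>r\<close> gives
  \<open>x * a * w * a = a\<close>.\<close>

lemma is_w_core_inverse_iff:
  "is_w_core_inverse w a x \<longleftrightarrow> is_core_inverse (a * w) x \<and> a \<in> right_ideal (a * w)"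
proof (intro iffI conjI)
  assume x: "is_w_core_inverse w a x"
  then have "a * w * x ^ 2 = x" "x * a * w * a = a" by (simp_all add: is_w_core_inverse_def)
  then have "a = a * w * (x ^ 2 * a * w * a)" by (metis mult.assoc)
  then show "a \<in> right_ideal (a * w)" by (auto simp: right_ideal_def)
  show "is_core_inverse (a * w) x" using x by (rule is_w_core_inverse_imp_core)
next
  assume "is_core_inverse (a * w) x \<and> a \<in> right_ideal (a * w)"
  then obtain r where x: "is_core_inverse (a * w) x" and r: "a = a * w * r"
    by (auto simp: right_ideal_def)
  have "x * a * w * a = a" using is_core_inverseD(2)[OF x] r by (metis mult.assoc)
  then show "is_w_core_inverse w a x"
    using x by (simp add: is_w_core_inverse_def is_core_inverse_def)
qed

lemma w_core_invertible_iff: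
  "w_core_invertible w a \<longleftrightarrow> a \<in> right_ideal (a * w) \<and> core_invertible (a * w)"
  by (auto simp: w_core_invertible_def core_invertible_def is_w_core_inverse_iff)

lemma w_core_invertible_imp_left_ideals:
  assumes "w_core_invertible w a"
  shows "a \<in> left_ideal (star (a * w) ^ Suc k * a)" "a \<in> left_ideal ((a * w) ^ k * a)"
proof -
  obtain x r where x: "is_core_inverse (a * w) x" and r: "a = a * w * r"
    using assms by (auto simp: w_core_invertible_def is_w_core_inverse_iff right_ideal_def)
  define b where "b = a * w"
  note x = x[folded b_def] and r = r[folded b_def]
  have "b ^ Suc k * x ^ Suc k * a = a"
    using core_inverse_power_mult[OF x, of k] is_core_inverseD(4)[OF x] r by (metis mult.assoc)
  \<comment> \<open>The product is the self-adjoint \<open>b * x\<close>, so it may be replaced by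
    its adjoint.\<close>
  moreover have "b ^ Suc k * x ^ Suc k = star x ^ Suc k * star b ^ Suc k"
    using core_inverse_power_mult[OF x, of k] is_core_inverseD(3)[OF x]
    by (metis star_mult star_power)
  ultimately have "a = star x ^ Suc k * (star b ^ Suc k * a)" by (metis mult.assoc)
  then show "a \<in> left_ideal (star (a * w) ^ Suc k * a)"
    unfolding left_ideal_def b_def by blast
  have "x ^ k * (b ^ k * (b * r)) = x ^ k * b ^ Suc k * r"
    by (simp only: power_Suc2 mult.assoc)
  then have "a = x ^ k * (b ^ k * a)" using core_inverse_power_absorb[OF x, of k] r by simp
  then show "a \<in> left_ideal ((a * w) ^ k * a)" unfolding left_ideal_def b_def by blast
qed

lemma left_ideals_imp_w_core_invertible:
  assumes "a \<in> left_ideal (star (a * w) ^ Suc (Suc m) * a)"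
    and "a \<in> left_ideal ((a * w) ^ Suc m * a)"
  shows "w_core_invertible w a"
proof -
  define b where "b = a * w"
  obtain s t where s: "a = s * (star b ^ Suc (Suc m) * a)" and t: "a = t * (b ^ Suc m * a)"
    using assms by (auto simp: left_ideal_def b_def)
  have sb: "b = s * (star b ^ Suc (Suc m) * b)" using s unfolding b_def by (metis mult.assoc)
  define y where "y = b ^ Suc m * star s"
  have y: "is_13_inverse b y" and a: "a = b * y * a"
    using star_power_projection[OF s sb] unfolding y_def by blast+
  have "b = b * y * b" using a unfolding b_def by (metis mult.assoc)
  \<comment> \<open>Here the exponent at least two matters: \<open>y\<close> itself still starts
    with a factor \<open>b\<close>.\<close>
  then have u: "b = b * b * (b ^ m * star s * b)"
    by (simp only: y_def power_Suc mult.assoc)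
  have "b = t * (b ^ Suc m * b)" using t unfolding b_def by (metis mult.assoc)
  then have "b = t * b ^ m * b * b" by (simp only: power_Suc2 mult.assoc)
  from is_core_inverse_group_13[OF u this y] have "core_invertible b"
    unfolding core_invertible_def by blast
  moreover have "a \<in> right_ideal b"
    using a unfolding right_ideal_def by (metis (mono_tags, lifting) mem_Collect_eq mult.assoc)
  ultimately show ?thesis by (simp add: w_core_invertible_iff b_def)
qed

text \<open>Identifies the factor \<open>x * a\<close> in \<open>x = x * a * w * y\<close>; it lies
  in \<open>a S\<close> because \<open>x = a * w * x ^ 2\<close>.\<close>

lemma is_inverse_along_w_core_inverse:
  assumes "is_w_core_inverse w a x"
  shows "is_inverse_along w a (x * a)"
proof -
  have x: "a * w * x ^ 2 = x" "x * a * w * a = a"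
    using assms by (simp_all add: is_w_core_inverse_def)
  have core: "is_core_inverse (a * w) x" and "a \<in> right_ideal (a * w)"
    using assms by (simp_all add: is_w_core_inverse_iff)
  then obtain r where r: "a = a * w * r" by (auto simp: right_ideal_def)
  have "a = a * w * (x * a)" using is_core_inverseD(4)[OF core] r by (metis mult.assoc)
  moreover have "x * a = a * (w * x ^ 2 * a)" using x by (metis mult.assoc)
  ultimately show ?thesis
    using x(2) unfolding is_inverse_along_def right_ideal_def left_ideal_def by blast
qed

text \<open>Taking adjoints in \<open>b * x = (b * y) * (b * x)\<close> gives
  \<open>b * x = (b * x) * (b * y) = b * y\<close>.\<close>

lemma is_13_inverse_mult_unique:
  assumes "is_13_inverse b x" "is_13_inverse b y"
  shows "b * x = b * y"
  using assms unfolding is_13_inverse_def by (metis mult.assoc star_mult)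

lemma core_inverse_eq_along_13:
  assumes x: "is_w_core_inverse w a x" and y: "is_13_inverse (a * w) y"
  shows "x = x * a * w * y"
proof -
  have core: "is_core_inverse (a * w) x" using x by (rule is_w_core_inverse_imp_core)
  have "x = x * (a * w * x)" using is_core_inverseD(5)[OF core] by simp
  also have "a * w * x = a * w * y"
    by (rule is_13_inverse_mult_unique[OF core_inverse_is_13_inverse[OF core] y])
  finally show ?thesis by (simp add: mult.assoc)
qed

end

theorem theorem2p10:
  fixes a w :: "'a::star_monoid" and n :: nat
  assumes "n \<ge> 2"
  shows
    "(w_core_invertible w a \<longleftrightarrow>
        a \<in> left_ideal ((star (a * w)) ^ n * a) \<inter> left_ideal ((a * w) ^ (n - 1) * a)) \<and>
     (w_core_invertible w a \<longleftrightarrow>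
        a \<in> right_ideal (a * w) \<and> core_invertible (a * w)) \<and>
     (w_core_invertible w a \<longrightarrow>
        w_core_inverse w a = core_inverse (a * w) \<and>
        invertible_along w a \<and>
        (\<exists>y. is_13_inverse (a * w) y) \<and>
        (\<forall>y. is_13_inverse (a * w) y \<longrightarrow>
           core_inverse (a * w) = inverse_along w a * w * y))"
proof (intro conjI impI)
  \<comment> \<open>Both exponents \<open>n\<close> and \<open>n - 1\<close> become successors,
    matching \<open>k = Suc m\<close> in the forward direction.\<close>
  obtain m where n: "n = Suc (Suc m)"
    using assms by (metis add_2_eq_Suc le_Suc_ex)
  show "w_core_invertible w a \<longleftrightarrow>
      a \<in> left_ideal ((star (a * w)) ^ n * a) \<inter> left_ideal ((a * w) ^ (n - 1) * a)"
    using w_core_invertible_imp_left_ideals[of w a] left_ideals_imp_w_core_invertible[of a w m]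
    unfolding n diff_Suc_1 by blast
  show "w_core_invertible w a \<longleftrightarrow> a \<in> right_ideal (a * w) \<and> core_invertible (a * w)"
    by (rule w_core_invertible_iff)
  assume "w_core_invertible w a"
  then obtain x where x: "is_w_core_inverse w a x" by (auto simp: w_core_invertible_def)
  note core = is_w_core_inverse_imp_core[OF x] and along = is_inverse_along_w_core_inverse[OF x]
  show "w_core_inverse w a = core_inverse (a * w)"
    by (simp add: w_core_inverse_eqI[OF x] core_inverse_eqI[OF core])
  show "invertible_along w a" using along by (auto simp: invertible_along_def)
  show "\<exists>y. is_13_inverse (a * w) y" using core_inverse_is_13_inverse[OF core] ..
  show "\<forall>y. is_13_inverse (a * w) y \<longrightarrow> core_inverse (a * w) = inverse_along w a * w * y"
    using core_inverse_eq_along_13[OF x]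
    by (simp add: core_inverse_eqI[OF core] inverse_along_eqI[OF along])
qed

end
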